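(* Let $k$ be a field of characteristic $0$ and let $(S,s)$ be a finite bijective set-theoretic solution of the reversed pentagon equation. Then each of the Hopf algebras $H_{\ell}(s)$ and $H_{r}(s)$ has a $k$-basis which is both positive and $\Phi$-set theoretic.
   Context: A set-theoretic solution of the reversed pentagon equation (RPE) is a pair $(S,s)$ with $S$ a set and $s:S\times S\to S\times S$ a map such that $s_{12}s_{13}s_{23}=s_{23}s_{12}$ as maps $S^3\to S^3$, where $s_{ij}$ acts as $s$ on the $i$-th and $j$-th coordinates and as the identity on the other one. It is finite (bijective) if $S$ is finite ($s$ is bijective). Write $s(x,y)=(\psi_y(x),\,y\circ x)$. Coefficient Hopf algebras. Let $S$ be finite and $A=\mathrm{End}_k(k[S])$, where $k[S]$ is the vector space with basis $S$. For $u,v\in S$ let $S_{u,v}\in A$ be the endomorphism with $S_{u,v}(v)=u$ and $S_{u,v}(w)=0$ for $w\in S\setminus\{v\}$. Put $R=\sum_{x,y\in S}S_{\psi_y(x),x}\otimes S_{y\circ x,y}\in A\otimes A$; this is the operator on $k[S]\otimes k[S]$ linearising $s$, and it is invertible when $s$ is bijective. Writing $R=\sum R^1\otimes R^2$, define $$H_{\ell}(s)=\Big\{\sum a^*(R^2)R^1 : a^*\in A^*\Big\},\qquad H_r(s)=\Big\{\sum a^*(R^1)R^2 : a^*\in A^*\Big\}.$$ These are unital subalgebras of $A$ and Hopf algebras (Davydov, Militaru) with the following structure maps. For $H_r(s)$: counit $\sum a^*(R^1)R^2\mapsto a^*(1)$, comultiplication $x\mapsto R(x\otimes 1)R^{-1}$,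 antipode $(a^*\otimes \mathrm{id})(R)\mapsto (a^*\otimes \mathrm{id})(R^{-1})$. For $H_\ell(s)$: counit $\sum a^*(R^2)R^1\mapsto a^*(1)$, comultiplication $x\mapsto R^{-1}(1\otimes x)R$, antipode $(\mathrm{id}\otimes a^* )(R)\mapsto(\mathrm{id}\otimes a^* )(R^{-1})$. A basis $\mathcal B$ of a Hopf algebra $H$ is positive if all structure constants with respect to $\mathcal B$ are nonnegative: the coordinates of $1_H$, the values $\varepsilon(b)$ for $b\in\mathcal B$, the coordinates of $bc$ for $b,c\in\mathcal B$, the coordinates of $\Delta(b)$ in the basis $\mathcal B\otimes\mathcal B$, and the coordinates of the antipode $S(b)$, for $b\in\mathcal B$. Nonnegativity of scalars is understood by viewing $k$ as a subfield of $\mathbb C$. For a Hopf algebra $H$ with multiplication $m$ and comultiplication $\Delta$ put $\Phi_H=(\mathrm{id}\otimes m)(\Delta\otimes\mathrm{id})$, i.e. $\Phi_H(x\otimes y)=x_{(1)}\otimes x_{(2)}y$. A basis $\mathcal B$ of $H$ is $\Phi$-set theoretic if for all $b,c\in\mathcal B$ there are $b',c'\in\mathcal B$ with $\Phi_H(b\otimes c)=b'\otimes c'$. *)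

theory Defs
  imports "HOL-Analysis.Analysis"
begin

definition s12 :: "('s \<times> 's \<Rightarrow> 's \<times> 's) \<Rightarrow> 's \<times> 's \<times> 's \<Rightarrow> 's \<times> 's \<times> 's" where
  "s12 s = (\<lambda>(x, y, z). let (x', y') = s (x, y) in (x', y', z))"

definition s13 :: "('s \<times> 's \<Rightarrow> 's \<times> 's) \<Rightarrow> 's \<times> 's \<times> 's \<Rightarrow> 's \<times> 's \<times> 's" where
  "s13 s = (\<lambda>(x, y, z). let (x', z') = s (x, z) in (x', y, z'))"

definition s23 :: "('s \<times> 's \<Rightarrow> 's \<times> 's) \<Rightarrow> 's \<times> 's \<times> 's \<Rightarrow> 's \<times> 's \<times> 's" where
  "s23 s = (\<lambda>(x, y, z). let (y', z') = s (y, z) in (x, y', z'))"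

definition reversed_pentagon :: "('s \<times> 's \<Rightarrow> 's \<times> 's) \<Rightarrow> bool" where
  "reversed_pentagon s \<longleftrightarrow> s12 s \<circ> s13 s \<circ> s23 s = s23 s \<circ> s12 s"

text \<open>
  For a finite type \<open>'s\<close>, the algebra of endomorphisms of the vector space with basis \<open>'s\<close> is
  the type \<open>'k^'s^'s\<close> with product \<open>**\<close> and unit \<open>mat 1\<close>; entry \<open>$ u $ v\<close> is the coefficient of
  \<open>u\<close> in the image of \<open>v\<close>. The tensor product of the algebras with index types \<open>'m\<close> and \<open>'n\<close>
  is identified, via the Kronecker product, with the algebra with index type \<open>'m \<times> 'n\<close>.
\<close>

definition mscale :: "'k::field \<Rightarrow> 'k^'n^'m \<Rightarrow> 'k^'n^'m" where
  "mscale c M = (\<chi> i j. c * M $ i $ j)"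

interpretation mat: vector_space "mscale :: 'k::field \<Rightarrow> 'k^'n^'m \<Rightarrow> 'k^'n^'m"
  by unfold_locales (simp_all add: mscale_def vec_eq_iff algebra_simps)

definition elem_mat :: "'s \<Rightarrow> 's \<Rightarrow> 'k::field^'s^'s" where
  "elem_mat u v = (\<chi> i j. if i = u \<and> j = v then 1 else 0)"

definition kron :: "'k::field^'m^'m \<Rightarrow> 'k^'n^'n \<Rightarrow> 'k^('m \<times> 'n)^('m \<times> 'n)" where
  "kron X Y = (\<chi> p q. X $ fst p $ fst q * Y $ snd p $ snd q)"

definition linear_functional :: "('k::field^'m^'m \<Rightarrow> 'k) \<Rightarrow> bool" where
  "linear_functional a \<longleftrightarrow> Vector_Spaces.linear mscale (*) a"

text \<open>\<open>slice_left a\<close> is a \<open>\<otimes>\<close> id and \<open>slice_right a\<close> is id \<open>\<otimes>\<close> a, where a is a linear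
  functional: \<open>slice_left a (kron X Y) = mscale (a X) Y\<close> and
  \<open>slice_right a (kron X Y) = mscale (a Y) X\<close>.\<close>

definition slice_left ::
    "('k::field^'m^'m \<Rightarrow> 'k) \<Rightarrow> 'k^('m \<times> 'n)^('m \<times> 'n) \<Rightarrow> 'k^'n^'n" where
  "slice_left a T = (\<chi> i j. a (\<chi> p q. T $ (p, i) $ (q, j)))"

definition slice_right ::
    "('k::field^'n^'n \<Rightarrow> 'k) \<Rightarrow> 'k^('m \<times> 'n)^('m \<times> 'n) \<Rightarrow> 'k^'m^'m" where
  "slice_right a T = (\<chi> i j. a (\<chi> p q. T $ (i, p) $ (j, q)))"

text \<open>id \<open>\<otimes>\<close> m, where m is the matrix product:
  \<open>id_tensor_mult (kron (kron X Y) Z) = kron X (Y ** Z)\<close>.\<close>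

definition id_tensor_mult ::
    "'k::field^(('m::finite \<times> 'n::finite) \<times> 'n)^(('m \<times> 'n) \<times> 'n) \<Rightarrow> 'k^('m \<times> 'n)^('m \<times> 'n)" where
  "id_tensor_mult W = (\<chi> p q. \<Sum>e\<in>UNIV. W $ (p, e) $ ((fst q, e), snd q))"

lemma slice_left_kron:
  assumes "linear_functional a"
  shows "slice_left a (kron X Y) = mscale (a X) Y"
proof -
  interpret Vector_Spaces.linear mscale "(*)" a
    using assms unfolding linear_functional_def .
  have "(\<chi> p q. X $ p $ q * Y $ i $ j) = mscale (Y $ i $ j) X" for i j
    by (simp add: mscale_def vec_eq_iff)
  then show ?thesis
    by (simp add: slice_left_def kron_def scale) (simp add: mscale_def mult.commute)
qed

lemma slice_right_kron:
  assumes "linear_functional a"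
  shows "slice_right a (kron X Y) = mscale (a Y) X"
proof -
  interpret Vector_Spaces.linear mscale "(*)" a
    using assms unfolding linear_functional_def .
  have "(\<chi> p q. X $ i $ j * Y $ p $ q) = mscale (X $ i $ j) Y" for i j
    by (simp add: mscale_def vec_eq_iff)
  then show ?thesis
    by (simp add: slice_right_def kron_def scale) (simp add: mscale_def mult.commute)
qed

lemma id_tensor_mult_kron: "id_tensor_mult (kron (kron X Y) Z) = kron X (Y ** Z)"
  by (simp add: id_tensor_mult_def kron_def matrix_matrix_mult_def vec_eq_iff
      sum_distrib_left mult.assoc)

text \<open>The structure maps of a Hopf algebra that is a unital subalgebra of a matrix algebra;
  product and unit are those of the matrix algebra. Only the values on the carrier matter.\<close>

record ('k, 'n) matrix_hopf =
  hcarrier :: "('k^'n^'n) set"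
  hcounit :: "'k^'n^'n \<Rightarrow> 'k"
  hcomult :: "'k^'n^'n \<Rightarrow> 'k^('n \<times> 'n)^('n \<times> 'n)"
  hantipode :: "'k^'n^'n \<Rightarrow> 'k^'n^'n"

definition is_basis :: "('k::field, 'n::finite) matrix_hopf \<Rightarrow> ('k^'n^'n) set \<Rightarrow> bool" where
  "is_basis H B \<longleftrightarrow> mat.independent B \<and> mat.span B = hcarrier H"

definition field_embedding :: "('k::field \<Rightarrow> complex) \<Rightarrow> bool" where
  "field_embedding \<iota> \<longleftrightarrow>
    \<iota> 1 = 1 \<and> (\<forall>x y. \<iota> (x + y) = \<iota> x + \<iota> y) \<and> (\<forall>x y. \<iota> (x * y) = \<iota> x * \<iota> y)"

text \<open>The membership in the span is needed: \<open>mat.representation B x\<close> is \<open>0\<close> outside of it.\<close>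

definition nonneg_coords ::
    "('k::field \<Rightarrow> complex) \<Rightarrow> ('k^'n^'n) set \<Rightarrow> 'k^'n^'n \<Rightarrow> bool" where
  "nonneg_coords \<iota> B x \<longleftrightarrow>
    x \<in> mat.span B \<and> (\<forall>b\<in>B. \<iota> (mat.representation B x b) \<in> \<real>\<^sub>\<ge>\<^sub>0)"

definition tensor_set :: "('k::field^'n^'n) set \<Rightarrow> ('k^('n \<times> 'n)^('n \<times> 'n)) set" where
  "tensor_set B = {kron b c | b c. b \<in> B \<and> c \<in> B}"

definition positive_basis ::
    "('k::field \<Rightarrow> complex) \<Rightarrow> ('k, 'n::finite) matrix_hopf \<Rightarrow> ('k^'n^'n) set \<Rightarrow> bool" where
  "positive_basis \<iota> H B \<longleftrightarrow>
    is_basis H B \<and>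
    nonneg_coords \<iota> B (mat 1) \<and>
    (\<forall>b\<in>B. \<iota> (hcounit H b) \<in> \<real>\<^sub>\<ge>\<^sub>0) \<and>
    (\<forall>b\<in>B. \<forall>c\<in>B. nonneg_coords \<iota> B (b ** c)) \<and>
    (\<forall>b\<in>B. nonneg_coords \<iota> (tensor_set B) (hcomult H b)) \<and>
    (\<forall>b\<in>B. nonneg_coords \<iota> B (hantipode H b))"

text \<open>The value of (id \<open>\<otimes>\<close> m)(\<open>\<Delta>\<close> \<open>\<otimes>\<close> id) at x \<open>\<otimes>\<close> y.\<close>

definition Phi ::
    "('k::field, 'n::finite) matrix_hopf \<Rightarrow> 'k^'n^'n \<Rightarrow> 'k^'n^'n \<Rightarrow> 'k^('n \<times> 'n)^('n \<times> 'n)" where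
  "Phi H x y = id_tensor_mult (kron (hcomult H x) y)"

definition Phi_set_theoretic_basis ::
    "('k::field, 'n::finite) matrix_hopf \<Rightarrow> ('k^'n^'n) set \<Rightarrow> bool" where
  "Phi_set_theoretic_basis H B \<longleftrightarrow>
    is_basis H B \<and> (\<forall>b\<in>B. \<forall>c\<in>B. \<exists>b'\<in>B. \<exists>c'\<in>B. Phi H b c = kron b' c')"

definition Rmat :: "('s::finite \<times> 's \<Rightarrow> 's \<times> 's) \<Rightarrow> 'k::field^('s \<times> 's)^('s \<times> 's)" where
  "Rmat s = (\<Sum>(x, y)\<in>UNIV. kron (elem_mat (fst (s (x, y))) x) (elem_mat (snd (s (x, y))) y))"

text \<open>Counit and antipode are prescribed on slices of \<open>R\<close>; that this determines well-defined
  maps on the carriers is a theorem for bijective solutions.\<close>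

definition H_left :: "('s::finite \<times> 's \<Rightarrow> 's \<times> 's) \<Rightarrow> ('k::field, 's) matrix_hopf" where
  "H_left s = (let R = Rmat s in
    \<lparr> hcarrier = {slice_right a R | a. linear_functional a},
      hcounit = (\<lambda>x. THE c. \<exists>a. linear_functional a \<and> x = slice_right a R \<and> c = a (mat 1)),
      hcomult = (\<lambda>x. matrix_inv R ** kron (mat 1) x ** R),
      hantipode = (\<lambda>x. THE y. \<exists>a. linear_functional a \<and> x = slice_right a R \<and>
                                   y = slice_right a (matrix_inv R)) \<rparr>)"

definition H_right :: "('s::finite \<times> 's \<Rightarrow> 's \<times> 's) \<Rightarrow> ('k::field, 's) matrix_hopf" where
  "H_right s = (let R = Rmat s in
    \<lparr> hcarrier = {slice_left a R | a. linear_functional a},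
      hcounit = (\<lambda>x. THE c. \<exists>a. linear_functional a \<and> x = slice_left a R \<and> c = a (mat 1)),
      hcomult = (\<lambda>x. R ** kron x (mat 1) ** matrix_inv R),
      hantipode = (\<lambda>x. THE y. \<exists>a. linear_functional a \<and> x = slice_left a R \<and>
                                   y = slice_left a (matrix_inv R)) \<rparr>)"

end

theory Submission
  imports Defs
begin

text \<open>
  Write \<open>s (x, y) = (\<psi>\<^sub>y x, yx)\<close>. The pentagon equation makes \<open>yx\<close> associative, and counting the
  preimages of \<open>S \<times> I\<close> under the bijection \<open>s\<close> for one-sided ideals \<open>I\<close> shows that all right
  multiplications are bijective; then so are all \<open>\<psi>\<^sub>y\<close>. Both families are groups acting freely on
  \<open>S\<close>, and the partition of \<open>S\<close> by equality of \<open>\<psi>\<^sub>y\<close> is preserved by right multiplications, as is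
  the partition by equality of right multiplications by the \<open>\<psi>\<^sub>y\<close>.

  The coefficient of the matrix unit \<open>E\<^sub>p\<^sub>q\<close> in the first tensor factor of \<open>R\<close> is the matrix of
  the partial map \<open>y \<mapsto> yq\<close> with domain \<open>{y. \<psi>\<^sub>y q = p}\<close>, and that of \<open>E\<^sub>p\<^sub>q\<close> in the second factor is
  the matrix of \<open>x \<mapsto> \<psi>\<^sub>q x\<close> with domain \<open>{x. qx = p}\<close>. By freeness, any two of these 0/1 matrices
  (for the same factor) are equal or have disjoint supports. The nonzero ones therefore form a basis,
  in which every 0/1 matrix of the algebra has coordinates 0 or 1. As \<open>R\<close> is a permutation matrix, all
  structure maps produce such matrices.
\<close>

text \<open>The axioms are symmetric in \<open>F\<close> and \<open>G\<close>, so that one argument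
  serves both \<open>H_right\<close> and \<open>H_left\<close>. Bijectivity and
  \<open>F_quot\<close> make the maps \<open>F j\<close> a group; \<open>F_free\<close> says that it
  acts freely.\<close>

locale free_pair =
  fixes F G :: "'s::finite \<Rightarrow> 's \<Rightarrow> 's"
  assumes F_bij: "bij (F j)"
    and G_bij: "bij (G q)"
    and F_quot: "\<exists>c. F c \<circ> F b = F a"
    and G_quot: "\<exists>c. G c \<circ> G b = G a"
    and F_free: "F j q = F j' q \<Longrightarrow> F j = F j'"
    and G_free: "G q j = G q' j \<Longrightarrow> G q = G q'"
    and F_G_cong: "F j = F j' \<Longrightarrow> F (G q j) = F (G q j')"
    and G_F_cong: "G q = G q' \<Longrightarrow> G (F j q) = G (F j q')"

lemma free_pair_swap: "free_pair F G \<Longrightarrow> free_pair G F"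
  unfolding free_pair_def by (elim conjE, intro conjI)

section \<open>Finite bijective solutions\<close>

locale bijective_RPE =
  fixes \<psi> :: "'s::finite \<Rightarrow> 's \<Rightarrow> 's" and mul :: "'s \<Rightarrow> 's \<Rightarrow> 's" (infixl "\<cdot>" 70)
  assumes assoc: "(z \<cdot> y) \<cdot> x = z \<cdot> (y \<cdot> x)"
    and psi_mul: "\<psi> z (y \<cdot> x) = \<psi> z y \<cdot> \<psi> (z \<cdot> y) x"
    and psi_psi: "\<psi> (\<psi> z y) (\<psi> (z \<cdot> y) x) = \<psi> y x"
    and bij_s: "bij (\<lambda>(x, y). (\<psi> y x, y \<cdot> x))"
begin

section \<open>Ideals and right multiplications\<close>

lemma s_inj: "\<psi> y x = \<psi> y' x' \<Longrightarrow> y \<cdot> x = y' \<cdot> x' \<Longrightarrow> x = x' \<and> y = y'"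
  using injD[OF bij_is_inj[OF bij_s], of "(x, y)" "(x', y')"] by simp

lemma s_surj: "\<exists>x y. \<psi> y x = u \<and> y \<cdot> x = v"
proof -
  obtain p where "(u, v) = (case p of (x, y) \<Rightarrow> (\<psi> y x, y \<cdot> x))"
    using surjD[OF bij_is_surj[OF bij_s], of "(u, v)"] by blast
  then show ?thesis
    by (cases p) auto
qed

text \<open>\<open>s\<close> maps \<open>UNIV \<times> I\<close> injectively into itself, hence onto
  by finiteness, so nothing outside is mapped into it.\<close>

lemma right_ideal_prime:
  assumes "\<And>y x. y \<in> I \<Longrightarrow> y \<cdot> x \<in> I" "y \<cdot> x \<in> I"
  shows "y \<in> I"
proof -
  let ?s = "\<lambda>(x, y). (\<psi> y x, y \<cdot> x)"
  have "?s ` (UNIV \<times> I) = UNIV \<times> I"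
    using assms(1) bij_is_inj[OF bij_s]
    by (intro card_subset_eq) (auto simp: card_image inj_on_subset)
  then have "?s (x, y) \<in> ?s ` (UNIV \<times> I)"
    using assms(2) by simp
  then have "(x, y) \<in> UNIV \<times> I"
    by (simp only: inj_image_mem_iff[OF bij_is_inj[OF bij_s]])
  then show ?thesis
    by simp
qed

text \<open>Here \<open>s\<close> maps \<open>I \<times> UNIV\<close> into
  \<open>UNIV \<times> I\<close>, which has the same cardinality and is therefore the exact
  image.\<close>

lemma left_ideal_prime:
  assumes "\<And>y x. x \<in> I \<Longrightarrow> y \<cdot> x \<in> I" "y \<cdot> x \<in> I"
  shows "x \<in> I"
proof -
  let ?s = "\<lambda>(x, y). (\<psi> y x, y \<cdot> x)"
  have inj: "inj_on ?s (I \<times> UNIV)"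
    using bij_is_inj[OF bij_s] inj_on_subset by blast
  have "?s ` (I \<times> UNIV) = UNIV \<times> I"
    using assms(1) card_image[OF inj]
    by (intro card_subset_eq) (auto simp: card_cartesian_product)
  then have "?s (x, y) \<in> ?s ` (I \<times> UNIV)"
    using assms(2) by simp
  then have "(x, y) \<in> I \<times> UNIV"
    by (simp only: inj_image_mem_iff[OF bij_is_inj[OF bij_s]])
  then show ?thesis
    by simp
qed

lemma left_simple_aux: "\<exists>a. x = a \<cdot> (z \<cdot> x)"
proof -
  \<comment> \<open>The set is the left ideal generated by \<open>z \<cdot> x\<close>. In the case
    \<open>x = z \<cdot> x\<close> the witness \<open>a = z\<close> works.\<close>
  have "x \<in> insert (z \<cdot> x) (range (\<lambda>a. a \<cdot> (z \<cdot> x)))"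
    by (rule left_ideal_prime[where y = z]) (auto simp: assoc[symmetric])
  then show ?thesis
    by auto
qed

lemma right_simple_aux: "\<exists>t. z = (z \<cdot> x) \<cdot> t"
proof -
  have "z \<in> insert (z \<cdot> x) (range (\<lambda>t. (z \<cdot> x) \<cdot> t))"
    by (rule right_ideal_prime[where x = x]) (auto simp: assoc)
  then show ?thesis
    by auto
qed

lemma psi_left_ideal:
  assumes "z \<cdot> x = z' \<cdot> x'"
  shows "\<exists>a. \<psi> z' x' = a \<cdot> \<psi> z x"
proof -
  obtain y where y: "x' = y \<cdot> x"
    using left_simple_aux[of x' z'] assms by (metis assoc)
  define z2 where "z2 = z' \<cdot> y"
  have z2: "z2 \<cdot> x = z \<cdot> x"
    using assms y by (simp add: z2_def assoc)
  obtain a where a: "x = a \<cdot> (z2 \<cdot> x)"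
    using left_simple_aux by blast
  obtain t where t: "z = (z \<cdot> x) \<cdot> t"
    using right_simple_aux by blast
  \<comment> \<open>\<open>w\<close> satisfies \<open>w \<cdot> x = x\<close> and
    \<open>z2 \<cdot> w = z\<close>, so \<open>psi_mul\<close> at \<open>w \<cdot> x\<close> trades
    the index \<open>z2\<close> for \<open>z\<close> at the cost of a left factor.\<close>
  define w where "w = a \<cdot> z"
  have "w \<cdot> x = x"
    using a z2 by (simp add: w_def assoc)
  moreover have "z2 \<cdot> w = z"
    by (metis a assoc t w_def z2)
  ultimately have "\<psi> z2 x = \<psi> z2 w \<cdot> \<psi> z x"
    using psi_mul[of z2 w x] by simp
  then have "\<psi> z' x' = (\<psi> z' y \<cdot> \<psi> z2 w) \<cdot> \<psi> z x"
    unfolding y psi_mul z2_def by (simp add: assoc)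
  then show ?thesis
    by blast
qed

text \<open>Surjectivity of \<open>s\<close> realises \<open>x\<close> and \<open>y\<close> as
  values of \<open>\<psi>\<close> at pairs with the same product; \<open>psi_left_ideal\<close>
  compares such values.\<close>

lemma right_mult_surj: "\<exists>a. a \<cdot> x = y"
proof -
  obtain u u' v v' where "\<psi> v u = x" "\<psi> v' u' = y" "v \<cdot> u = v' \<cdot> u'"
    using s_surj[of x x] s_surj[of y x] by metis
  then show ?thesis
    using psi_left_ideal by metis
qed

lemma right_mult_bij: "bij (\<lambda>y. y \<cdot> x)"
proof -
  have "surj (\<lambda>y. y \<cdot> x)"
  proof (rule surjI)
    show "(SOME a. a \<cdot> x = y) \<cdot> x = y" for y
      by (rule someI_ex) (rule right_mult_surj)
  qed
  then show ?thesis
    by (simp add: bij_def finite_UNIV_surj_inj)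
qed

lemma right_cancel: "y \<cdot> x = y' \<cdot> x \<longleftrightarrow> y = y'"
  using bij_is_inj[OF right_mult_bij] by (rule inj_eq)

text \<open>Every \<open>z\<close> is a left multiple of \<open>y\<close>, so agreement at one point
  spreads by associativity. This is freeness of the right multiplications.\<close>

lemma right_mult_free:
  assumes "y \<cdot> q = y \<cdot> q'"
  shows "z \<cdot> q = z \<cdot> q'"
proof -
  obtain t where "z = t \<cdot> y"
    using right_mult_surj[of y z] by blast
  then show ?thesis
    using assms by (simp add: assoc)
qed

section \<open>Right units and right inverses\<close>

definition right_unit :: "'s \<Rightarrow> bool" where
  "right_unit e \<longleftrightarrow> (\<forall>x. x \<cdot> e = x)"

lemma right_unitD: "right_unit e \<Longrightarrow> x \<cdot> e = x"
  by (simp add: right_unit_def)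

lemma right_unitI:
  assumes "y \<cdot> e = y"
  shows "right_unit e"
  unfolding right_unit_def
proof
  fix x
  obtain t where "x = t \<cdot> y"
    using right_mult_surj[of y x] by blast
  then show "x \<cdot> e = x"
    using assms by (simp add: assoc)
qed

text \<open>If \<open>e \<cdot> x = x\<close>, then cancelling \<open>x\<close> makes
  \<open>e\<close> idempotent, hence a right unit. If moreover \<open>x' \<cdot> x = e\<close>, then
  \<open>x \<cdot> x'\<close> is idempotent too.\<close>

lemma ex_right_inverse: "\<exists>x'. right_unit (x \<cdot> x')"
proof -
  obtain e where e: "e \<cdot> x = x"
    using right_mult_surj by blast
  then have "(e \<cdot> e) \<cdot> x = e \<cdot> x"
    by (simp add: assoc)
  then have "right_unit e"
    by (intro right_unitI) (simp add: right_cancel)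
  obtain x' where x': "x' \<cdot> x = e"
    using right_mult_surj by blast
  have "x \<cdot> (x' \<cdot> x) = x"
    unfolding x' by (rule right_unitD) fact
  then have "(x \<cdot> x') \<cdot> (x \<cdot> x') = x \<cdot> x'"
    by (simp only: assoc[symmetric])
  then have "right_unit (x \<cdot> x')"
    by (rule right_unitI)
  then show ?thesis ..
qed

lemma ex_right_unit: "\<exists>e. right_unit e"
  using ex_right_inverse by blast

text \<open>Since \<open>z \<cdot> e = z\<close>, \<open>psi_mul\<close> at
  \<open>e \<cdot> e = e\<close> shows that \<open>\<psi> z e\<close> is idempotent.\<close>

lemma right_unit_psi:
  assumes "right_unit e"
  shows "right_unit (\<psi> z e)"
proof -
  obtain z' where "z = z' \<cdot> e"
    using assms right_unitD by metis
  then show ?thesis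
    using psi_mul[of z' e e] assms by (metis right_unitD right_unitI)
qed

text \<open>Surjectivity of \<open>s\<close> makes \<open>y \<mapsto> e \<cdot> \<psi>\<^sub>e y\<close> a surjective, hence injective, self-map of the right
  ideal \<open>e \<cdot> S\<close>; it takes the value \<open>e\<close> at both \<open>e \<cdot> b\<close> and \<open>e\<close>.\<close>

lemma right_unit_if_psi:
  assumes "\<And>z. right_unit (\<psi> z b)"
  shows "right_unit b"
proof -
  obtain e where e: "right_unit e"
    using ex_right_unit by blast
  define k where "k y = e \<cdot> \<psi> e y" for y
  let ?H = "range (\<lambda>x. e \<cdot> x)"
  have "?H \<subseteq> k ` ?H"
  proof
    fix w assume "w \<in> ?H"
    then have w: "e \<cdot> w = w"
      using e by (auto simp: assoc[symmetric] right_unitD)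
    \<comment> \<open>With \<open>u\<close> a right inverse of \<open>w\<close>, a preimage
      \<open>(x, y)\<close> of \<open>(u, e)\<close> under \<open>s\<close> gives
      \<open>k y \<cdot> u = e = w \<cdot> u\<close>, and \<open>u\<close> cancels.\<close>
    obtain u where u: "right_unit (w \<cdot> u)"
      using ex_right_inverse by blast
    obtain x y where xy: "\<psi> y x = u" "y \<cdot> x = e"
      using s_surj by blast
    have "y \<cdot> x \<in> ?H"
      using xy(2) right_unitD[OF e] by (metis rangeI)
    then have y: "y \<in> ?H"
      by (rule right_ideal_prime[rotated]) (auto simp: assoc)
    then have ey: "e \<cdot> y = y"
      using e by (auto simp: assoc[symmetric] right_unitD)
    have "\<psi> e y \<cdot> u = \<psi> e e"
      using psi_mul[of e y x] xy ey by simp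
    then have "k y \<cdot> u = e"
      by (simp add: k_def assoc right_unitD right_unit_psi e)
    also have "e = w \<cdot> u"
      using right_unitD[OF u, of e] by (simp add: assoc[symmetric] w)
    finally have "k y = w"
      by (simp only: right_cancel)
    then show "w \<in> k ` ?H"
      using y by blast
  qed
  then have "inj_on k ?H"
    by (meson card_image_le eq_card_imp_inj_on card_mono finite le_antisym)
  moreover have "k (e \<cdot> b) = k (e \<cdot> e)"
    using e assms by (simp add: k_def psi_mul right_unitD right_unit_psi)
  ultimately have "e \<cdot> b = e \<cdot> e"
    by (auto dest: inj_onD)
  then show ?thesis
    using e by (simp add: right_unitD right_unitI)
qed

section \<open>Bijectivity and freeness of the maps \<open>\<psi> y\<close>\<close>

lemma psi_inj:
  assumes "\<psi> y a = \<psi> y b"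
  shows "a = b"
proof -
  \<comment> \<open>If \<open>t \<cdot> z = y\<close>, then \<open>psi_psi\<close> factors
    \<open>\<psi> z\<close> through \<open>\<psi> y\<close>.\<close>
  have all: "\<psi> z a = \<psi> z b" for z
    using right_mult_surj[of z y] assms psi_psi by metis
  \<comment> \<open>Both \<open>c \<cdot> a\<close> and \<open>c \<cdot> b\<close> turn out to be
    right units, so \<open>a\<close> and \<open>b\<close> have the same right multiplication;
    injectivity of \<open>s\<close> then separates them no further.\<close>
  obtain c where c: "right_unit (c \<cdot> a)"
    using ex_right_unit right_mult_surj by metis
  have "\<psi> z (c \<cdot> b) = \<psi> z (c \<cdot> a)" for z
    by (simp add: psi_mul all)
  then have "right_unit (c \<cdot> b)"
    using right_unit_if_psi right_unit_psi[OF c] by metis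
  then have "y \<cdot> a = y \<cdot> b"
    using c right_mult_free by (metis assoc right_unitD)
  then show ?thesis
    using s_inj assms by blast
qed

lemma psi_bij: "bij (\<psi> y)"
proof -
  have "inj (\<psi> y)"
    by (rule injI) (rule psi_inj)
  then show ?thesis
    by (simp add: bij_def finite_UNIV_inj_surj)
qed

text \<open>The right-hand side \<open>\<psi> q x\<close> of \<open>psi_psi\<close> does not involve
  \<open>y\<close>; the outer maps agree by assumption and are injective.\<close>

lemma psi_mult_eq:
  assumes "\<psi> y q = \<psi> y' q"
  shows "\<psi> (y \<cdot> q) = \<psi> (y' \<cdot> q)"
proof
  fix x
  have "\<psi> (\<psi> y q) (\<psi> (y \<cdot> q) x) = \<psi> (\<psi> y q) (\<psi> (y' \<cdot> q) x)"
    using psi_psi[of y q x] psi_psi[of y' q x] assms by simp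
  then show "\<psi> (y \<cdot> q) x = \<psi> (y' \<cdot> q) x"
    by (rule psi_inj)
qed

text \<open>A second use of \<open>psi_mult_eq\<close>, at a right inverse of \<open>q\<close>,
  undoes the multiplication by \<open>q\<close>.\<close>

lemma psi_free:
  assumes "\<psi> y q = \<psi> y' q"
  shows "\<psi> y = \<psi> y'"
proof -
  obtain q' where q': "right_unit (q \<cdot> q')"
    using ex_right_inverse by blast
  have "\<psi> (y \<cdot> q \<cdot> q') = \<psi> (y' \<cdot> q \<cdot> q')"
    using psi_mult_eq[OF assms] by (intro psi_mult_eq) simp
  then show ?thesis
    by (simp add: assoc right_unitD[OF q'])
qed

lemma free_pair: "free_pair \<psi> (\<lambda>q j. j \<cdot> q)"
proof
  show "bij (\<psi> j)" "bij (\<lambda>j. j \<cdot> q)" for j q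
    using psi_bij right_mult_bij by auto
  show "\<exists>c. \<psi> c \<circ> \<psi> b = \<psi> a" for a b
  proof -
    obtain z where "z \<cdot> a = b"
      using right_mult_surj by blast
    then have "\<psi> (\<psi> z a) \<circ> \<psi> b = \<psi> a"
      using psi_psi[of z a] by auto
    then show ?thesis ..
  qed
  show "\<exists>c. (\<lambda>j. j \<cdot> c) \<circ> (\<lambda>j. j \<cdot> b) = (\<lambda>j. j \<cdot> a)" for a b
  proof -
    obtain b' where "right_unit (b \<cdot> b')"
      using ex_right_inverse by blast
    then have "(j \<cdot> b) \<cdot> (b' \<cdot> a) = j \<cdot> a" for j
      using assoc[of j "b \<cdot> b'" a] by (simp add: assoc right_unitD)
    then have "(\<lambda>j. j \<cdot> (b' \<cdot> a)) \<circ> (\<lambda>j. j \<cdot> b) = (\<lambda>j. j \<cdot> a)"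
      by (simp add: fun_eq_iff)
    then show ?thesis ..
  qed
  show "\<psi> j = \<psi> j'" if "\<psi> j q = \<psi> j' q" for j j' q
    using that by (rule psi_free)
  show "(\<lambda>j. j \<cdot> q) = (\<lambda>j. j \<cdot> q')" if "j \<cdot> q = j \<cdot> q'" for j q q'
    by (intro ext) (rule right_mult_free[OF that])
  show "\<psi> (j \<cdot> q) = \<psi> (j' \<cdot> q)" if "\<psi> j = \<psi> j'" for j j' q
    by (rule psi_mult_eq) (simp add: that)
  show "(\<lambda>i. i \<cdot> \<psi> j q) = (\<lambda>i. i \<cdot> \<psi> j q')" if "(\<lambda>j. j \<cdot> q) = (\<lambda>j. j \<cdot> q')" for j q q'
  proof -
    \<comment> \<open>By this choice \<open>psi_mul\<close> splits
      \<open>\<psi> z (q \<cdot> q)\<close> and \<open>\<psi> z (q \<cdot> q')\<close> into the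
      common left factor \<open>\<psi> z q\<close> and \<open>\<psi> j q\<close>,
      \<open>\<psi> j q'\<close>.\<close>
    obtain z where z: "z \<cdot> q = j"
      using right_mult_surj by blast
    have "\<psi> z q \<cdot> \<psi> j q = \<psi> z q \<cdot> \<psi> j q'"
    proof -
      have "\<psi> z (q \<cdot> q) = \<psi> z (q \<cdot> q')"
        using fun_cong[OF that, of q] by (rule arg_cong)
      then show ?thesis
        unfolding psi_mul z .
    qed
    then show ?thesis
      by (intro ext) (rule right_mult_free)
  qed
qed

end

section \<open>Disjoint 0/1 matrices\<close>

definition pmat :: "('b \<Rightarrow> 'a option) \<Rightarrow> 'k::field^'b^'a" where
  "pmat f = (\<chi> i j. if f j = Some i then 1 else 0)"

lemma pmat_nth [simp]: "pmat f $ i $ j = (if f j = Some i then 1 else 0)"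
  by (simp add: pmat_def)

lemma mat_1_eq_pmat: "mat 1 = pmat Some"
  by (auto simp: vec_eq_iff mat_def)

lemma pmat_mult:
  "pmat f ** pmat g = (pmat (\<lambda>j. Option.bind (g j) f) :: 'k::field^'c::finite^'a)"
  for f :: "'b::finite \<Rightarrow> 'a::finite option"
proof -
  have "(\<Sum>k\<in>UNIV. pmat f $ i $ k * pmat g $ k $ j) =
      (pmat (\<lambda>j. Option.bind (g j) f) $ i $ j :: 'k)" for i j
  proof (cases "g j")
    case (Some l)
    then have "(\<Sum>k\<in>UNIV. pmat f $ i $ k * pmat g $ k $ j) =
        (\<Sum>k\<in>UNIV. if k = l then pmat f $ i $ k else (0 :: 'k))"
      by (intro sum.cong) auto
    then show ?thesis
      using Some by simp
  qed simp
  then show ?thesis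
    by (simp add: matrix_matrix_mult_def vec_eq_iff)
qed

lemma kron_pmat:
  "kron (pmat f) (pmat g) = pmat (\<lambda>(c, d). Option.bind (f c) (\<lambda>a. map_option (Pair a) (g d)))"
  by (auto simp: vec_eq_iff kron_def bind_eq_Some_conv)

lemma kron_sum_left: "kron (\<Sum>m\<in>A. X m) Y = (\<Sum>m\<in>A. kron (X m) Y)"
  by (simp add: vec_eq_iff kron_def sum_distrib_right)

lemma id_tensor_mult_sum: "id_tensor_mult (\<Sum>m\<in>A. W m) = (\<Sum>m\<in>A. id_tensor_mult (W m))"
proof -
  have "(\<Sum>e\<in>UNIV. \<Sum>m\<in>A. W m $ (p, e) $ ((r, e), q)) =
      (\<Sum>m\<in>A. \<Sum>e\<in>UNIV. W m $ (p, e) $ ((r, e), q))" for p q r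
    by (rule sum.swap)
  then show ?thesis
    by (simp add: id_tensor_mult_def vec_eq_iff)
qed

lemma kron_0 [simp]: "kron X 0 = 0" "kron 0 Y = 0"
  by (simp_all add: vec_eq_iff kron_def)

lemma matrix_inv_pmat_bij:
  fixes s :: "'a::finite \<Rightarrow> 'a"
  assumes "bij s"
  defines "R \<equiv> pmat (\<lambda>x. Some (s x)) :: 'k::field^'a^'a"
  shows "matrix_inv R = transpose R" and "R ** matrix_inv R = mat 1" and "matrix_inv R ** R = mat 1"
proof -
  have T: "transpose R = pmat (\<lambda>x. Some (inv s x))"
    by (auto simp: R_def vec_eq_iff transpose_def surj_f_inv_f[OF bij_is_surj[OF assms(1)]]
        inv_f_f[OF bij_is_inj[OF assms(1)]])
  have 1: "R ** transpose R = mat 1" "transpose R ** R = mat 1"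
    unfolding T mat_1_eq_pmat
    by (simp_all add: R_def pmat_mult surj_f_inv_f[OF bij_is_surj[OF assms(1)]]
        inv_f_f[OF bij_is_inj[OF assms(1)]])
  have 2: "R ** matrix_inv R = mat 1 \<and> matrix_inv R ** R = mat 1"
    unfolding matrix_inv_def by (rule someI[where x = "transpose R"]) (use 1 in simp)
  then show "R ** matrix_inv R = mat 1" "matrix_inv R ** R = mat 1"
    by auto
  show "matrix_inv R = transpose R"
  proof -
    have "matrix_inv R = (matrix_inv R ** R) ** transpose R"
      by (simp only: matrix_mul_assoc[symmetric] 1 matrix_mul_rid)
    then show ?thesis
      by (simp add: 2)
  qed
qed

section \<open>Linear functionals on matrix algebras\<close>

lemma linear_functionalI:
  assumes "\<And>x y. a (x + y) = a x + a y" "\<And>c x. a (mscale c x) = c * a x"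
  shows "linear_functional a"
  unfolding linear_functional_def
  by unfold_locales (simp_all add: assms algebra_simps)

lemma linear_functional_add: "linear_functional a \<Longrightarrow> a (x + y) = a x + a y"
  unfolding linear_functional_def by (rule Vector_Spaces.linear.axioms(3)[THEN module_hom.add])

lemma linear_functional_scale: "linear_functional a \<Longrightarrow> a (mscale c x) = c * a x"
  unfolding linear_functional_def by (rule Vector_Spaces.linear.axioms(3)[THEN module_hom.scale])

lemma linear_functional_0: "linear_functional a \<Longrightarrow> a 0 = 0"
  using linear_functional_scale[of a 0 0] by (simp add: mscale_def zero_vec_def)

lemma linear_functional_sum: "linear_functional a \<Longrightarrow> a (sum f A) = (\<Sum>x\<in>A. a (f x))"
  by (induction A rule: infinite_finite_induct)
    (simp_all add: linear_functional_0 linear_functional_add)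

lemma linear_functional_nth: "linear_functional (\<lambda>X. X $ p $ q)"
  by (rule linear_functionalI) (simp_all add: mscale_def)

lemma linear_functional_expand:
  fixes X :: "'k::field^'m::finite^'m"
  assumes "linear_functional a"
  shows "a X = (\<Sum>p\<in>UNIV. \<Sum>q\<in>UNIV. a (elem_mat p q) * X $ p $ q)"
proof -
  have "(\<Sum>p\<in>UNIV. \<Sum>q\<in>UNIV. X $ p $ q * (if i = p \<and> j = q then 1 else 0)) = X $ i $ j" for i j
  proof -
    have "(\<Sum>q\<in>UNIV. X $ p $ q * (if i = p \<and> j = q then 1 else 0)) =
        (if p = i then X $ i $ j else 0)" for p
      by (auto simp: if_distrib cong: if_cong)
    then show ?thesis
      by simp
  qed
  then have "X = (\<Sum>p\<in>UNIV. \<Sum>q\<in>UNIV. mscale (X $ p $ q) (elem_mat p q))"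
    by (simp add: vec_eq_iff mscale_def elem_mat_def)
  then have "a X = a (\<Sum>p\<in>UNIV. \<Sum>q\<in>UNIV. mscale (X $ p $ q) (elem_mat p q))"
    by (rule arg_cong)
  also have "\<dots> = (\<Sum>p\<in>UNIV. \<Sum>q\<in>UNIV. X $ p $ q * a (elem_mat p q))"
    by (simp add: linear_functional_sum linear_functional_scale assms)
  finally show ?thesis
    by (simp add: mult.commute)
qed

section \<open>Families of 0/1 matrices with disjoint supports\<close>

definition disjoint_01 :: "('k::field^'n^'m) set \<Rightarrow> bool" where
  "disjoint_01 B \<longleftrightarrow> 0 \<notin> B \<and> (\<forall>b\<in>B. \<forall>i j. b $ i $ j \<in> {0, 1}) \<and>
    (\<forall>b\<in>B. \<forall>c\<in>B. \<forall>i j. b $ i $ j = 1 \<longrightarrow> c $ i $ j = 1 \<longrightarrow> b = c)"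

lemma disjoint_01_entry:
  assumes "disjoint_01 B" "b \<in> B"
  shows "b $ i $ j = 0 \<or> b $ i $ j = 1"
proof -
  have "b $ i $ j \<in> {0, 1}"
    using assms by (simp add: disjoint_01_def)
  then show ?thesis
    by simp
qed

lemma disjoint_01_eq:
  assumes "disjoint_01 B" "b \<in> B" "c \<in> B" "b $ i $ j = 1" "c $ i $ j = 1"
  shows "b = c"
  using assms unfolding disjoint_01_def by blast

lemma disjoint_01_ex_1:
  assumes "disjoint_01 B" "b \<in> B"
  obtains i j where "b $ i $ j = 1"
proof -
  have "b \<noteq> 0"
    using assms by (auto simp: disjoint_01_def)
  then obtain i j where "b $ i $ j \<noteq> 0"
    by (auto simp: vec_eq_iff)
  then show ?thesis
    using that disjoint_01_entry[OF assms, of i j] by simp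
qed

text \<open>On the support of \<open>b\<close> all other members vanish, so one entry reads off the
  coefficient of \<open>b\<close>. Independence and the coordinates both come from this.\<close>

lemma disjoint_01_sum_nth:
  assumes B: "disjoint_01 B" and t: "finite t" "t \<subseteq> B" and b: "b \<in> B" "b $ i $ j = 1"
  shows "(\<Sum>v\<in>t. mscale (u v) v) $ i $ j = (if b \<in> t then u b else 0)"
proof -
  have "v $ i $ j = (if v = b then 1 else 0)" if "v \<in> t" for v
  proof (cases "v = b")
    case False
    have v: "v \<in> B"
      using that t(2) by (rule subsetD[rotated])
    have "v $ i $ j \<noteq> 1"
      using disjoint_01_eq[OF B v b(1) _ b(2)] False by blast
    then show ?thesis
      using disjoint_01_entry[OF B v, of i j] False by simp
  qed (simp add: b(2))
  then have "(\<Sum>v\<in>t. u v * v $ i $ j) = (\<Sum>v\<in>t. if v = b then u v else 0)"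
    by (intro sum.cong) auto
  also have "\<dots> = (if b \<in> t then u b else 0)"
    using t by simp
  finally show ?thesis
    by (simp add: mscale_def)
qed

lemma disjoint_01_independent:
  assumes "disjoint_01 B"
  shows "mat.independent B"
  unfolding mat.independent_explicit_module
proof (intro allI impI)
  fix t u v
  assume t: "finite t" "t \<subseteq> B" "(\<Sum>v\<in>t. mscale (u v) v) = 0" "v \<in> t"
  have v: "v \<in> B"
    using t by auto
  obtain i j where ij: "v $ i $ j = 1"
    using disjoint_01_ex_1[OF assms v] .
  have "u v = (\<Sum>v\<in>t. mscale (u v) v) $ i $ j"
    using disjoint_01_sum_nth[OF assms t(1,2) v ij, of u] t(4) by simp
  also have "\<dots> = 0"
    unfolding t(3) by simp
  finally show "u v = 0" .
qed

lemma kron_nth: "kron X Y $ (i, k) $ (j, l) = X $ i $ j * Y $ k $ l"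
  by (simp add: kron_def)

text \<open>The support of a Kronecker product is the product of the supports.\<close>

lemma disjoint_01_tensor_set:
  assumes B: "disjoint_01 B"
  shows "disjoint_01 (tensor_set B)"
  unfolding disjoint_01_def
proof (intro conjI ballI allI impI notI)
  assume "0 \<in> tensor_set B"
  then obtain b c where bc: "b \<in> B" "c \<in> B" "kron b c = 0"
    by (auto simp: tensor_set_def)
  obtain i j where "b $ i $ j = 1"
    using disjoint_01_ex_1[OF B bc(1)] .
  moreover obtain k l where "c $ k $ l = 1"
    using disjoint_01_ex_1[OF B bc(2)] .
  ultimately have "kron b c $ (i, k) $ (j, l) = 1"
    by (simp add: kron_nth)
  then show False
    by (simp add: bc(3))
next
  fix x i j
  assume "x \<in> tensor_set B"
  then obtain b c where bc: "b \<in> B" "c \<in> B" "x = kron b c"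
    by (auto simp: tensor_set_def)
  show "x $ i $ j \<in> {0, 1}"
    using disjoint_01_entry[OF B bc(1), of "fst i" "fst j"]
      disjoint_01_entry[OF B bc(2), of "snd i" "snd j"]
    by (auto simp: bc(3) kron_def)
next
  fix x y i j
  assume "x \<in> tensor_set B" "y \<in> tensor_set B"
  then obtain b c b' c' where bc: "b \<in> B" "c \<in> B" "x = kron b c"
    and bc': "b' \<in> B" "c' \<in> B" "y = kron b' c'"
    by (auto simp: tensor_set_def)
  have *: "b $ fst i $ fst j = 1 \<and> c $ snd i $ snd j = 1"
    if "b \<in> B" "c \<in> B" "kron b c $ i $ j = 1" for b c
    using disjoint_01_entry[OF B that(1), of "fst i" "fst j"]
      disjoint_01_entry[OF B that(2), of "snd i" "snd j"] that(3)
    by (auto simp: kron_def)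
  assume "x $ i $ j = 1" "y $ i $ j = 1"
  then have 1: "b $ fst i $ fst j = 1" "c $ snd i $ snd j = 1"
      "b' $ fst i $ fst j = 1" "c' $ snd i $ snd j = 1"
    using *[OF bc(1,2)] *[OF bc'(1,2)] unfolding bc(3) bc'(3) by auto
  have "b = b'"
    using disjoint_01_eq[OF B bc(1) bc'(1) 1(1,3)] .
  moreover have "c = c'"
    using disjoint_01_eq[OF B bc(2) bc'(2) 1(2,4)] .
  ultimately show "x = y"
    by (simp only: bc(3) bc'(3))
qed

lemma field_embedding_0: "field_embedding \<iota> \<Longrightarrow> \<iota> 0 = 0"
proof -
  assume "field_embedding \<iota>"
  then have "\<iota> (0 + 0) = \<iota> 0 + \<iota> 0"
    unfolding field_embedding_def by blast
  then show ?thesis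
    by simp
qed

lemma field_embedding_01:
  assumes "field_embedding \<iota>" "x \<in> {0, 1}"
  shows "\<iota> x \<in> \<real>\<^sub>\<ge>\<^sub>0"
  using assms field_embedding_0[OF assms(1)] by (auto simp: field_embedding_def)

text \<open>The coordinate of \<open>x\<close> at \<open>b\<close> is the entry of \<open>x\<close>
  at any position in the support of \<open>b\<close>.\<close>

lemma disjoint_01_nonneg_coords:
  assumes "field_embedding \<iota>" and B: "disjoint_01 B" and x: "x \<in> mat.span B"
    and 01: "\<And>i j. x $ i $ j \<in> {0, 1}"
  shows "nonneg_coords \<iota> B x"
  unfolding nonneg_coords_def
proof (intro conjI ballI x)
  fix b assume b: "b \<in> B"
  then obtain i j where ij: "b $ i $ j = 1"
    using disjoint_01_ex_1[OF B] by blast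
  let ?r = "mat.representation B x"
  have "(\<Sum>b | ?r b \<noteq> 0. mscale (?r b) b) = x"
    by (rule mat.sum_nonzero_representation_eq[OF disjoint_01_independent[OF B] x])
  then have "x $ i $ j = (\<Sum>b | ?r b \<noteq> 0. mscale (?r b) b) $ i $ j"
    by (simp only:)
  also have "\<dots> = ?r b"
    using mat.finite_representation mat.representation_ne_zero b ij
    by (subst disjoint_01_sum_nth[OF B _ _ b ij]) auto
  finally have "?r b \<in> {0, 1}"
    using 01[of i j] by (simp only:)
  then show "\<iota> (?r b) \<in> \<real>\<^sub>\<ge>\<^sub>0"
    by (rule field_embedding_01[OF assms(1)])
qed

section \<open>Coefficient Hopf algebras of a free pair\<close>

text \<open>With \<open>(F j q, G q j) = (\<psi>\<^sub>j q, jq)\<close> these matrices are the coefficients of \<open>R\<close> for \<open>H_right\<close>; with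
  \<open>(F j q, G q j) = (qj, \<psi>\<^sub>q j)\<close> they are those for \<open>H_left\<close>.\<close>

definition pcoeff :: "('s \<Rightarrow> 's \<Rightarrow> 's) \<Rightarrow> ('s \<Rightarrow> 's \<Rightarrow> 's) \<Rightarrow> 's \<Rightarrow> 's \<Rightarrow> 'k::field^'s^'s" where
  "pcoeff F G p q = pmat (\<lambda>j. if F j q = p then Some (G q j) else None)"

lemma pcoeff_nth: "pcoeff F G p q $ i $ j = (if F j q = p \<and> G q j = i then 1 else 0)"
  by (simp add: pcoeff_def)

definition pslice ::
    "('s \<Rightarrow> 's \<Rightarrow> 's) \<Rightarrow> ('s \<Rightarrow> 's \<Rightarrow> 's) \<Rightarrow> ('k::field^'s^'s \<Rightarrow> 'k) \<Rightarrow> 'k^'s^'s" where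
  "pslice F G a = (\<chi> i j. a (\<chi> p q. pcoeff F G p q $ i $ j))"

text \<open>The slice of the inverse of \<open>R\<close>: as this inverse is the transpose, both
  index pairs are swapped.\<close>

definition pslice_antipode ::
    "('s \<Rightarrow> 's \<Rightarrow> 's) \<Rightarrow> ('s \<Rightarrow> 's \<Rightarrow> 's) \<Rightarrow> ('k::field^'s^'s \<Rightarrow> 'k) \<Rightarrow> 'k^'s^'s" where
  "pslice_antipode F G a = (\<chi> i j. a (\<chi> p q. pcoeff F G q p $ j $ i))"

lemma pslice_nth_functional: "pslice F G (\<lambda>X. X $ p $ q) = pcoeff F G p q"
  by (simp add: pslice_def vec_eq_iff)

lemma pslice_antipode_nth_functional:
  "pslice_antipode F G (\<lambda>X. X $ p $ q) = transpose (pcoeff F G q p)"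
  by (simp add: pslice_antipode_def transpose_def vec_eq_iff)

text \<open>The sum will be the comultiplication of \<open>pcoeff F G p q\<close>. In column
  \<open>(c, d)\<close> only \<open>m = F d q\<close> can contribute, so the sum is again the 0/1
  matrix of a partial map.\<close>

lemma sum_kron_pcoeff:
  fixes F G :: "'s::finite \<Rightarrow> 's \<Rightarrow> 's"
  shows "(\<Sum>m\<in>UNIV. kron (pcoeff F G p m) (pcoeff F G m q)) =
    (pmat (\<lambda>(c, d). if F c (F d q) = p then Some (G (F d q) c, G q d) else None)
      :: 'k::field^('s \<times> 's)^('s \<times> 's))"
proof -
  have "(\<Sum>m\<in>UNIV. kron (pcoeff F G p m) (pcoeff F G m q) $ (a, b) $ (c, d)) =
    (if F c (F d q) = p \<and> G (F d q) c = a \<and> G q d = b then 1 else (0 :: 'k))" for a b c d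
  proof -
    have "(\<Sum>m\<in>UNIV. kron (pcoeff F G p m) (pcoeff F G m q) $ (a, b) $ (c, d)) =
      (\<Sum>m\<in>UNIV. if m = F d q
        then (if F c m = p \<and> G m c = a \<and> G q d = b then 1 else (0 :: 'k)) else 0)"
      by (intro sum.cong) (auto simp: kron_def pcoeff_nth)
    then show ?thesis
      by simp
  qed
  then show ?thesis
    by (simp add: vec_eq_iff)
qed

context free_pair
begin

section \<open>The group structure of the two families\<close>

lemma G_id: "\<exists>e. G e = id"
proof -
  \<comment> \<open>Any index serves: the quotient of \<open>G ?q\<close> by itself is the
    identity.\<close>
  let ?q = "undefined :: 's"
  obtain c where c: "G c \<circ> G ?q = G ?q"
    using G_quot by blast
  have "G c x = x" for x
  proof -
    obtain y where "G ?q y = x"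
      using bij_is_surj[OF G_bij[of ?q]] by (metis surjD)
    then show ?thesis
      using fun_cong[OF c, of y] by simp
  qed
  then have "G c = id"
    by (simp add: fun_eq_iff)
  then show ?thesis ..
qed

lemma G_inverse: "\<exists>c. \<forall>j. G c (G b j) = j"
proof -
  obtain e where e: "G e = id"
    using G_id by blast
  obtain c where "G c \<circ> G b = G e"
    using G_quot by blast
  then have "G c (G b j) = j" for j
    by (simp add: e fun_eq_iff)
  then show ?thesis
    by blast
qed

lemma G_inverse': "\<exists>c. \<forall>j. G c (G b j) = j \<and> G b (G c j) = j"
proof -
  obtain c where c: "\<And>j. G c (G b j) = j"
    using G_inverse by blast
  moreover have "G b (G c j) = j" for j
    using c[of "G c j"] bij_is_inj[OF G_bij[of c]] by (simp add: inj_eq)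
  ultimately show ?thesis
    by blast
qed

lemma G_comp: "\<exists>c. \<forall>j. G c j = G a (G b j)"
proof -
  obtain b' where b': "\<And>j. G b' (G b j) = j" "\<And>j. G b (G b' j) = j"
    using G_inverse' by blast
  obtain c where c: "G c \<circ> G b' = G a"
    using G_quot by blast
  have "G c j = G a (G b j)" for j
    using fun_cong[OF c, of "G b j"] by (simp add: b')
  then show ?thesis
    by blast
qed

text \<open>The inverse of \<open>G q\<close> belongs to the family, so \<open>F_G_cong\<close>
  applies to it as well.\<close>

lemma F_G_cong_iff: "F (G q j) = F (G q j') \<longleftrightarrow> F j = F j'"
proof
  assume a: "F (G q j) = F (G q j')"
  obtain c where "\<And>j. G c (G q j) = j"
    using G_inverse by blast
  then show "F j = F j'"
    using F_G_cong[OF a, of c] by simp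
qed (rule F_G_cong)

lemmas F_id = free_pair.G_id[OF free_pair_swap[OF free_pair_axioms]]
lemmas F_inverse = free_pair.G_inverse'[OF free_pair_swap[OF free_pair_axioms]]
lemmas G_F_cong_iff = free_pair.F_G_cong_iff[OF free_pair_swap[OF free_pair_axioms]]

lemma F_eq_iff: "F j q = F j' q \<longleftrightarrow> F j = F j'"
  by (rule iffI, erule F_free, simp)

lemma G_eq_iff: "G q j = G q' j \<longleftrightarrow> G q = G q'"
  by (rule iffI, erule G_free, simp)

section \<open>The basis and its span\<close>

abbreviation "M \<equiv> pcoeff F G"

definition basis :: "('k::field^'s^'s) set" where
  "basis = {M p q | p q. True} - {0}"

lemma M_eq_0_iff: "M p q = (0 :: 'k::field^'s^'s) \<longleftrightarrow> (\<forall>j. F j q \<noteq> p)"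
  by (auto simp: vec_eq_iff pcoeff_nth)

lemma M_in_basis: "M (F j q) q \<in> basis"
  using M_eq_0_iff[of "F j q" q] by (auto simp: basis_def)

lemma basisE:
  assumes "b \<in> basis"
  obtains j q where "b = M (F j q) q"
proof -
  obtain p q where b: "b = M p q" "M p q \<noteq> (0 :: 'a^'s^'s)"
    using assms by (auto simp: basis_def)
  then obtain j where "F j q = p"
    using M_eq_0_iff by blast
  then show ?thesis
    using that b by blast
qed

lemma M_in_span_basis: "M p q \<in> mat.span basis"
proof (cases "M p q = (0 :: 'a^'s^'s)")
  case True
  show ?thesis
    unfolding True by (rule mat.span_zero)
next
  case False
  then show ?thesis
    by (intro mat.span_base) (auto simp: basis_def)
qed

text \<open>A common 1 in column \<open>j\<close> forces \<open>G q = G q'\<close> by freeness. Both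
  domains are then the class of all \<open>x\<close> with \<open>F x = F j\<close>, again by
  freeness.\<close>

lemma disjoint_01_basis: "disjoint_01 (basis :: ('k::field^'s^'s) set)"
proof -
  have "M p q = (M p' q' :: 'k^'s^'s)"
    if "M p q $ i $ j = (1 :: 'k)" "M p' q' $ i $ j = (1 :: 'k)" for p q p' q' i j
  proof -
    have *: "F j q = p" "F j q' = p'" "G q j = i" "G q' j = i"
      using that by (auto simp: pcoeff_nth split: if_splits)
    then have "G q = G q'"
      by (intro G_free[of q j q']) simp
    then show ?thesis
      using *(1,2) by (auto simp: vec_eq_iff pcoeff_nth F_eq_iff)
  qed
  moreover have "M p q $ i $ j \<in> {0, 1 :: 'k}" for p q i j
    by (simp add: pcoeff_nth)
  ultimately show ?thesis
    unfolding disjoint_01_def basis_def by blast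
qed

text \<open>Expanding a functional in matrix units writes its slice through the
  \<open>M p q\<close>. Conversely the slices form a subspace, and entry functionals yield the
  \<open>M p q\<close>.\<close>

lemma slices_eq_span:
  "{pslice F G a | a. linear_functional (a :: 'k::field^'s^'s \<Rightarrow> 'k)} = mat.span basis"
proof
  show "{pslice F G a | a. linear_functional (a :: 'k^'s^'s \<Rightarrow> 'k)} \<subseteq> mat.span basis"
  proof safe
    fix a :: "'k^'s^'s \<Rightarrow> 'k" assume a: "linear_functional a"
    have "pslice F G a = (\<Sum>p\<in>UNIV. \<Sum>q\<in>UNIV. mscale (a (elem_mat p q)) (M p q))"
    proof -
      have "a (\<chi> p q. M p q $ i $ j) = (\<Sum>p\<in>UNIV. \<Sum>q\<in>UNIV. a (elem_mat p q) * M p q $ i $ j)" for i j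
        by (subst linear_functional_expand[OF a]) simp
      then show ?thesis
        by (simp add: vec_eq_iff pslice_def mscale_def)
    qed
    also have "\<dots> \<in> mat.span basis"
      by (intro mat.span_sum mat.span_scale M_in_span_basis)
    finally show "pslice F G a \<in> mat.span basis" .
  qed
  have "mat.subspace {pslice F G a | a. linear_functional (a :: 'k^'s^'s \<Rightarrow> 'k)}"
    unfolding mat.subspace_def
  proof (intro conjI ballI allI)
    have "pslice F G (\<lambda>_. 0) = 0"
      by (simp add: pslice_def vec_eq_iff)
    moreover have "linear_functional (\<lambda>_ :: 'k^'s^'s. 0)"
      by (rule linear_functionalI) simp_all
    ultimately show "0 \<in> {pslice F G a | a. linear_functional (a :: 'k^'s^'s \<Rightarrow> 'k)}"
      by (intro CollectI exI[where x = "\<lambda>_. 0"]) simp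
  next
    fix x y
    assume "x \<in> {pslice F G a | a. linear_functional (a :: 'k^'s^'s \<Rightarrow> 'k)}"
      and "y \<in> {pslice F G a | a. linear_functional (a :: 'k^'s^'s \<Rightarrow> 'k)}"
    then obtain a b where ab: "linear_functional a" "linear_functional b"
      "x = pslice F G a" "y = pslice F G b"
      by auto
    then have "x + y = pslice F G (\<lambda>X. a X + b X)"
      by (simp add: pslice_def vec_eq_iff)
    moreover have "linear_functional (\<lambda>X. a X + b X)"
      using ab by (intro linear_functionalI)
        (simp_all add: linear_functional_add linear_functional_scale algebra_simps)
    ultimately show "x + y \<in> {pslice F G a | a. linear_functional (a :: 'k^'s^'s \<Rightarrow> 'k)}"
      by (intro CollectI exI conjI)
  next
    fix c x
    assume "x \<in> {pslice F G a | a. linear_functional (a :: 'k^'s^'s \<Rightarrow> 'k)}"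
    then obtain a where a: "linear_functional a" "x = pslice F G a"
      by auto
    then have "mscale c x = pslice F G (\<lambda>X. c * a X)"
      by (simp add: pslice_def vec_eq_iff mscale_def)
    moreover have "linear_functional (\<lambda>X. c * a X)"
      using a by (intro linear_functionalI)
        (simp_all add: linear_functional_add linear_functional_scale algebra_simps)
    ultimately show "mscale c x \<in> {pslice F G a | a. linear_functional (a :: 'k^'s^'s \<Rightarrow> 'k)}"
      by (intro CollectI exI conjI)
  qed
  moreover have "basis \<subseteq> {pslice F G a | a. linear_functional (a :: 'k^'s^'s \<Rightarrow> 'k)}"
  proof
    fix b :: "'k^'s^'s" assume "b \<in> basis"
    then obtain p q where "b = pslice F G (\<lambda>X. X $ p $ q)"
      by (auto simp: basis_def pslice_nth_functional)
    then show "b \<in> {pslice F G a | a. linear_functional a}"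
      using linear_functional_nth by (intro CollectI exI conjI)
  qed
  ultimately show "mat.span basis \<subseteq> {pslice F G a | a. linear_functional (a :: 'k^'s^'s \<Rightarrow> 'k)}"
    by (intro mat.span_minimal)
qed

section \<open>Unit, products and transposes\<close>

lemma mat_1_in_span: "mat 1 \<in> mat.span basis"
proof -
  obtain q where q: "G q = id"
    using G_id by blast
  \<comment> \<open>For fixed \<open>q\<close> the domains of the \<open>M p q\<close> partition the
    set, and each acts there as \<open>G q = id\<close>.\<close>
  have "mat 1 = (\<Sum>p\<in>UNIV. M p q)"
    by (simp add: vec_eq_iff pcoeff_nth q mat_def flip: if_if_eq_conj)
  also have "\<dots> \<in> mat.span basis"
    by (intro mat.span_sum M_in_span_basis)
  finally show ?thesis .
qed

text \<open>The right factor has domain \<open>F x = F j\<close>, on which \<open>F (G q' x)\<close>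
  is constant by \<open>F_G_cong\<close>. Hence the composite is defined on all of this domain or
  nowhere.\<close>

lemma M_mult:
  assumes "\<And>i. G r i = G q (G q' i)"
  shows "M m q ** M (F j q') q' = (if m = F (G q' j) q then M (F j r) r else 0)"
proof -
  have "M m q ** M (F j q') q' = pmat (\<lambda>x. if F x q' = F j q' then
      (if F (G q' x) q = m then Some (G r x) else None) else None)"
    unfolding pcoeff_def pmat_mult assms by (intro arg_cong[where f = pmat] ext) simp
  also have "\<dots> = (if m = F (G q' j) q then M (F j r) r else 0)"
  proof -
    have "F x q' = F j q' \<and> F (G q' x) q = m \<longleftrightarrow> m = F (G q' j) q \<and> F x r = F j r" for x
      unfolding F_eq_iff using F_G_cong[of x j q'] by auto
    then show ?thesis
      by (auto simp: vec_eq_iff pcoeff_nth simp flip: if_if_eq_conj)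
  qed
  finally show ?thesis .
qed

text \<open>The transpose belongs to the inverse partial map: it acts by the inverse of
  \<open>G p\<close> on the image of a class of \<open>F\<close>, which is again such a
  class.\<close>

lemma transpose_M: "\<exists>p' q'. transpose (M (F j p) p) = M p' q'"
proof -
  obtain q where q: "\<And>j. G q (G p j) = j" "\<And>j. G p (G q j) = j"
    using G_inverse' by blast
  have "F i = F j \<and> G p i = k \<longleftrightarrow> F k = F (G p j) \<and> G q k = i" for i k
  proof -
    have "G p i = k \<longleftrightarrow> G q k = i"
      using q(1)[of i] q(2)[of k] by metis
    moreover have "F i = F j \<longleftrightarrow> F (G p i) = F (G p j)"
      by (simp only: F_G_cong_iff)
    ultimately show ?thesis
      by auto
  qed
  then have "transpose (M (F j p) p) = M (F (G p j) q) q"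
    by (auto simp: vec_eq_iff transpose_def pcoeff_nth F_eq_iff)
  then show ?thesis
    by blast
qed

lemma transpose_M_in_span: "transpose (M q p) \<in> mat.span basis"
proof (cases "M q p = (0 :: 'a^'s^'s)")
  case True
  have "transpose (M q p) = (0 :: 'a^'s^'s)"
    unfolding True by (simp add: transpose_def vec_eq_iff)
  then show ?thesis
    by (simp only: mat.span_zero)
next
  case False
  then obtain j where q: "q = F j p"
    using M_eq_0_iff by blast
  obtain p' q' where "transpose (M q p) = (M p' q' :: 'a^'s^'s)"
    unfolding q using transpose_M by blast
  then show ?thesis
    by (simp only: M_in_span_basis)
qed

section \<open>Well-definedness of counit and antipode\<close>

lemma functional_mat_1:
  assumes "F j = id" and a: "linear_functional a"
  shows "a (mat 1) = (\<Sum>v\<in>UNIV. pslice F G a $ v $ j)"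
proof -
  \<comment> \<open>As \<open>F j = id\<close>, column \<open>j\<close> of \<open>M p q\<close>
    vanishes unless \<open>p = q\<close>, and then its sum is 1.\<close>
  have "(\<Sum>v\<in>UNIV. (if F j q = p \<and> G q j = v then 1 else 0)) =
      (if p = q then 1 else 0 :: 'a)" for p q
    using assms(1) by auto
  then have "mat 1 = (\<Sum>v\<in>UNIV. \<chi> p q. (M p q $ v $ j :: 'a))"
    by (simp add: vec_eq_iff pcoeff_nth mat_def)
  then show ?thesis
    by (simp add: linear_functional_sum[OF a] pslice_def)
qed

lemma functional_mat_1_unique:
  assumes "linear_functional a" "linear_functional b" "pslice F G a = pslice F G b"
  shows "a (mat 1) = b (mat 1)"
proof -
  obtain j where "F j = id"
    using F_id by blast
  then show ?thesis
    by (simp only: functional_mat_1 assms)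
qed

text \<open>Every entry of the antipode of \<open>x\<close> is \<open>0\<close> or an entry of \<open>x\<close> at a position that does not
  depend on \<open>x\<close>; hence the antipode is well defined on slices.\<close>

lemma transpose_M_entry:
  "(\<forall>p q. M q p $ j $ i = (0 :: 'k::field)) \<or>
   (\<exists>v y. \<forall>p q. M q p $ j $ i = (M p q $ v $ y :: 'k))"
proof (cases "\<exists>p. G p i = j")
  case False
  then show ?thesis
    by (simp add: pcoeff_nth)
next
  case True
  then obtain p0 where p0: "G p0 i = j"
    by blast
  \<comment> \<open>With \<open>F y\<close> inverse to \<open>F i\<close>, the condition
    \<open>F i p = q\<close> becomes \<open>F y q = p\<close>, while \<open>G_F_cong_iff\<close> and
    freeness move \<open>G p i = j\<close> to the column \<open>y\<close>.\<close>
  obtain y where y: "\<And>x. F y (F i x) = x" "\<And>x. F i (F y x) = x"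
    using F_inverse[of i] by blast
  have "F i p = q \<and> G p i = j \<longleftrightarrow> F y q = p \<and> G q y = G (F i p0) y" for p q
  proof -
    have "G p i = j \<longleftrightarrow> G p = G p0"
      unfolding p0[symmetric] by (rule G_eq_iff)
    also have "\<dots> \<longleftrightarrow> G (F i p) = G (F i p0)"
      by (simp add: G_F_cong_iff)
    also have "\<dots> \<longleftrightarrow> G (F i p) y = G (F i p0) y"
      by (rule G_eq_iff[symmetric])
    finally have "G p i = j \<longleftrightarrow> G (F i p) y = G (F i p0) y" .
    moreover have "F i p = q \<longleftrightarrow> F y q = p"
      using y(1)[of p] y(2)[of q] by metis
    ultimately show ?thesis
      by auto
  qed
  then have "\<forall>p q. M q p $ j $ i = (M p q $ G (F i p0) y $ y :: 'k)"
    by (simp add: pcoeff_nth)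
  then show ?thesis
    by blast
qed

lemma pslice_antipode_unique:
  assumes ab: "linear_functional a" "linear_functional b" "pslice F G a = pslice F G b"
  shows "pslice_antipode F G a = pslice_antipode F G b"
proof -
  have "a (\<chi> p q. M q p $ j $ i) = b (\<chi> p q. M q p $ j $ i)" for i j
    using transpose_M_entry[of j i, where 'k = 'a]
  proof
    assume "\<forall>p q. M q p $ j $ i = (0 :: 'a)"
    then have "(\<chi> p q. M q p $ j $ i) = (0 :: 'a^'s^'s)"
      by (simp add: vec_eq_iff)
    then show ?thesis
      using ab by (simp add: linear_functional_0)
  next
    assume "\<exists>v y. \<forall>p q. M q p $ j $ i = (M p q $ v $ y :: 'a)"
    then obtain v y where "(\<chi> p q. M q p $ j $ i) = (\<chi> p q. (M p q $ v $ y :: 'a))"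
      by auto
    then show ?thesis
      using arg_cong[OF ab(3), of "\<lambda>x. x $ v $ y"] by (simp add: pslice_def)
  qed
  then show ?thesis
    by (simp add: pslice_antipode_def)
qed

text \<open>The condition on \<open>hcomult\<close> says that the \<open>M p q\<close> comultiply
  like the entries of a matrix comodule; it is checked separately for the two sides.\<close>

lemma positive_Phi_set_theoretic_basis:
  fixes H :: "('k::field, 's) matrix_hopf" and \<iota> :: "'k \<Rightarrow> complex"
  assumes carrier: "hcarrier H = {pslice F G a | a. linear_functional a}"
    and counit: "hcounit H =
      (\<lambda>x. THE c. \<exists>a. linear_functional a \<and> x = pslice F G a \<and> c = a (mat 1))"
    and comult: "\<And>p q. hcomult H (M p q) = (\<Sum>m\<in>UNIV. kron (M p m) (M m q))"
    and antipode: "hantipode H =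
      (\<lambda>x. THE y. \<exists>a. linear_functional a \<and> x = pslice F G a \<and> y = pslice_antipode F G a)"
    and \<iota>: "field_embedding \<iota>"
  shows "positive_basis \<iota> H basis \<and> Phi_set_theoretic_basis H basis"
proof -
  let ?M = "\<lambda>p q. M p q :: 'k^'s^'s"
  note nonneg = disjoint_01_nonneg_coords[OF \<iota> disjoint_01_basis]
  have basis: "is_basis H basis"
    unfolding is_basis_def carrier slices_eq_span
    using disjoint_01_independent[OF disjoint_01_basis] by blast
  have counit_M: "hcounit H (?M p q) = mat 1 $ p $ q" for p q
    unfolding counit
  proof (rule the_equality)
    show "\<exists>a. linear_functional a \<and> ?M p q = pslice F G a \<and> mat 1 $ p $ q = a (mat 1)"
      by (rule exI[where x = "\<lambda>X. X $ p $ q"]) (simp add: linear_functional_nth pslice_nth_functional)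
  next
    fix c assume "\<exists>a. linear_functional a \<and> ?M p q = pslice F G a \<and> c = a (mat 1)"
    then obtain a where a: "linear_functional a" "pslice F G a = ?M p q" "c = a (mat 1)"
      by auto
    show "c = mat 1 $ p $ q"
      unfolding a(3)
      by (rule functional_mat_1_unique[OF a(1) linear_functional_nth])
        (simp only: a(2) pslice_nth_functional)
  qed
  have antipode_M: "hantipode H (?M p q) = transpose (M q p)" for p q
    unfolding antipode
  proof (rule the_equality)
    show "\<exists>a. linear_functional a \<and> ?M p q = pslice F G a \<and>
        transpose (M q p) = (pslice_antipode F G a :: 'k^'s^'s)"
      by (rule exI[where x = "\<lambda>X. X $ p $ q"])
        (simp add: linear_functional_nth pslice_nth_functional pslice_antipode_nth_functional)
  next
    fix c :: "'k^'s^'s"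
    assume "\<exists>a. linear_functional a \<and> ?M p q = pslice F G a \<and> c = pslice_antipode F G a"
    then obtain a where a: "linear_functional a" "pslice F G a = ?M p q" "c = pslice_antipode F G a"
      by auto
    show "c = transpose (M q p)"
      unfolding a(3) pslice_antipode_nth_functional[symmetric]
      by (rule pslice_antipode_unique[OF a(1) linear_functional_nth])
        (simp only: a(2) pslice_nth_functional)
  qed
  \<comment> \<open>One \<open>r\<close> serves all \<open>m\<close>, as needed for the sum over
    \<open>m\<close> in \<open>Phi\<close>.\<close>
  have mult: "\<exists>r. \<forall>m. ?M m q ** ?M (F j q') q' =
      (if m = F (G q' j) q then ?M (F j r) r else 0)" for q j q'
  proof -
    obtain r where r: "\<And>i. G r i = G q (G q' i)"
      using G_comp by blast
    show ?thesis
      by (rule exI[where x = r]) (simp only: M_mult[OF r] simp_thms)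
  qed
  have "positive_basis \<iota> H basis"
    unfolding positive_basis_def
  proof (intro conjI ballI basis)
    show "nonneg_coords \<iota> basis (mat 1)"
      by (rule nonneg[OF mat_1_in_span]) (simp add: mat_def)
  next
    fix b :: "'k^'s^'s" assume "b \<in> basis"
    then obtain j q where b: "b = ?M (F j q) q"
      by (rule basisE)
    show "\<iota> (hcounit H b) \<in> \<real>\<^sub>\<ge>\<^sub>0"
      unfolding b counit_M by (rule field_embedding_01[OF \<iota>]) (simp add: mat_def)
    show "nonneg_coords \<iota> basis (hantipode H b)"
      unfolding b antipode_M
      by (rule nonneg[OF transpose_M_in_span]) (simp add: transpose_def pcoeff_nth)
    have "kron (?M p m) (?M m q) \<in> mat.span (tensor_set basis)" for p m q
    proof (cases "?M p m = 0 \<or> ?M m q = 0")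
      case True
      then have "kron (?M p m) (?M m q) = (0 :: 'k^('s \<times> 's)^('s \<times> 's))"
        by auto
      then show ?thesis
        by (simp only: mat.span_zero)
    next
      case False
      then show ?thesis
        by (intro mat.span_base) (auto simp: tensor_set_def basis_def)
    qed
    then have "hcomult H b \<in> mat.span (tensor_set basis)"
      unfolding b comult by (intro mat.span_sum)
    then show "nonneg_coords \<iota> (tensor_set basis) (hcomult H b)"
      by (rule disjoint_01_nonneg_coords[OF \<iota> disjoint_01_tensor_set[OF disjoint_01_basis]])
        (simp add: b comult sum_kron_pcoeff)
  next
    fix b c :: "'k^'s^'s" assume "b \<in> basis" "c \<in> basis"
    then obtain i q j q' where b: "b = ?M (F i q) q" and c: "c = ?M (F j q') q'"
      by (elim basisE)
    obtain r where r: "b ** c = (if F i q = F (G q' j) q then ?M (F j r) r else 0)"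
      unfolding b c using mult by blast
    have "b ** c \<in> mat.span basis"
      unfolding r using M_in_span_basis mat.span_zero by auto
    then show "nonneg_coords \<iota> basis (b ** c)"
      by (rule nonneg) (simp add: r pcoeff_nth)
  qed
  moreover have "Phi_set_theoretic_basis H basis"
    unfolding Phi_set_theoretic_basis_def
  proof (intro conjI ballI basis)
    fix b c :: "'k^'s^'s" assume "b \<in> basis" "c \<in> basis"
    then obtain i q j q' where b: "b = ?M (F i q) q" and c: "c = ?M (F j q') q'"
      by (elim basisE)
    obtain r where r: "\<And>m. ?M m q ** c = (if m = F (G q' j) q then ?M (F j r) r else 0)"
      unfolding c using mult by blast
    \<comment> \<open>The only index whose summand in \<open>Phi H b c\<close> survives.\<close>
    define m where "m = F (G q' j) q"
    have "Phi H b c = (\<Sum>n\<in>UNIV. kron (?M (F i q) n) (?M n q ** c))"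
      by (simp add: Phi_def b comult kron_sum_left id_tensor_mult_sum id_tensor_mult_kron)
    also have "\<dots> = (\<Sum>n\<in>UNIV. if n = m then kron (?M (F i q) n) (?M (F j r) r) else 0)"
      by (intro sum.cong) (auto simp: r m_def)
    also have "\<dots> = kron (?M (F i q) m) (?M (F j r) r)"
      by simp
    finally have Phi: "Phi H b c = kron (?M (F i q) m) (?M (F j r) r)" .
    \<comment> \<open>The quotient of \<open>F i\<close> by \<open>F (G q' j)\<close> takes
      \<open>m\<close> to \<open>F i q\<close>, so the first tensor factor is nonzero.\<close>
    obtain l where l: "F l \<circ> F (G q' j) = F i"
      using F_quot by blast
    have "F i q = F l m"
      using fun_cong[OF l, of q] by (simp add: m_def)
    then have "?M (F i q) m \<in> basis"
      by (simp only: M_in_basis)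
    then show "\<exists>b'\<in>basis. \<exists>c'\<in>basis. Phi H b c = kron b' c'"
      using Phi M_in_basis by (intro bexI)
  qed
  ultimately show ?thesis
    by blast
qed

end

section \<open>The solution \<open>R\<close>\<close>

lemma Rmat_eq_pmat:
  fixes s :: "'s::finite \<times> 's \<Rightarrow> 's \<times> 's"
  shows "Rmat s = (pmat (\<lambda>x. Some (s x)) :: 'k::field^('s \<times> 's)^('s \<times> 's))"
proof -
  have "(\<Sum>(x, y)\<in>UNIV. kron (elem_mat (fst (s (x, y))) x) (elem_mat (snd (s (x, y))) y)) $ i $ j =
      (if s j = i then 1 else (0 :: 'k))" for i j
  proof -
    have "(\<Sum>(x, y)\<in>UNIV. kron (elem_mat (fst (s (x, y))) x) (elem_mat (snd (s (x, y))) y)) $ i $ j =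
      (\<Sum>z\<in>UNIV. if z = j then (if s z = i then 1 else (0 :: 'k)) else 0)"
      unfolding sum_component
      by (intro sum.cong) (auto simp: kron_def elem_mat_def prod_eq_iff)
    then show ?thesis
      by simp
  qed
  then show ?thesis
    by (simp add: Rmat_def vec_eq_iff)
qed

lemma bijective_RPE_of_solution:
  fixes s :: "'s::finite \<times> 's \<Rightarrow> 's \<times> 's"
  assumes "reversed_pentagon s" "bij s"
  shows "bijective_RPE (\<lambda>y x. fst (s (x, y))) (\<lambda>y x. snd (s (x, y)))"
proof -
  define \<psi> where "\<psi> = (\<lambda>y x. fst (s (x, y)))"
  define m where "m = (\<lambda>y x. snd (s (x, y)))"
  have s: "s (x, y) = (\<psi> y x, m y x)" for x y
    by (simp add: \<psi>_def m_def)
  have "(s12 s \<circ> s13 s \<circ> s23 s) (x, y, z) = (s23 s \<circ> s12 s) (x, y, z)" for x y z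
    using assms(1) by (simp add: reversed_pentagon_def)
  then have *: "\<psi> (\<psi> z y) (\<psi> (m z y) x) = \<psi> y x \<and> m (\<psi> z y) (\<psi> (m z y) x) = \<psi> z (m y x) \<and>
      m (m z y) x = m z (m y x)" for x y z
    by (simp add: s12_def s13_def s23_def s)
  have "bij (\<lambda>(x, y). (\<psi> y x, m y x))"
    using assms(2) by (simp add: s[symmetric] case_prod_unfold)
  then have "bijective_RPE \<psi> m"
    using * by unfold_locales auto
  then show ?thesis
    by (simp add: \<psi>_def m_def)
qed

lemma transpose_nth: "transpose A $ i $ j = A $ j $ i"
  by (simp add: transpose_def)

context
  fixes s :: "'s::finite \<times> 's \<Rightarrow> 's \<times> 's"
  assumes RPE: "reversed_pentagon s" and bij: "bij s"
begin

interpretation bijective_RPE "\<lambda>y x. fst (s (x, y))" "\<lambda>y x. snd (s (x, y))"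
  using bijective_RPE_of_solution[OF RPE bij] .

lemma Rmat_inverse:
  "matrix_inv (Rmat s) = transpose (Rmat s :: 'k::field^('s \<times> 's)^('s \<times> 's))"
  "Rmat s ** matrix_inv (Rmat s) = (mat 1 :: 'k::field^('s \<times> 's)^('s \<times> 's))"
  "matrix_inv (Rmat s) ** Rmat s = (mat 1 :: 'k::field^('s \<times> 's)^('s \<times> 's))"
  unfolding Rmat_eq_pmat using matrix_inv_pmat_bij[OF bij] .

lemma H_right_basis:
  fixes \<iota> :: "'k::field \<Rightarrow> complex"
  assumes "field_embedding \<iota>"
  shows "\<exists>B :: ('k^'s^'s) set.
    positive_basis \<iota> (H_right s) B \<and> Phi_set_theoretic_basis (H_right s) B"
proof -
  let ?F = "\<lambda>j q. fst (s (q, j))" and ?G = "\<lambda>q j. snd (s (q, j))"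
  let ?M = "\<lambda>p q. pcoeff ?F ?G p q :: 'k^'s^'s"
  interpret free_pair ?F ?G
    by (rule free_pair)
  have R: "Rmat s $ (p, i) $ (q, j) = ?M p q $ i $ j" for p i q j
    by (simp add: Rmat_eq_pmat pcoeff_nth prod_eq_iff)
  have slice: "slice_left a (Rmat s) = pslice ?F ?G a" for a :: "'k^'s^'s \<Rightarrow> 'k"
    by (simp add: slice_left_def pslice_def R)
  have slice_inv: "slice_left a (matrix_inv (Rmat s)) = pslice_antipode ?F ?G a"
    for a :: "'k^'s^'s \<Rightarrow> 'k"
    by (simp add: slice_left_def pslice_antipode_def R Rmat_inverse(1) transpose_nth)
  have comult: "Rmat s ** kron (?M p q) (mat 1) ** matrix_inv (Rmat s) =
      (\<Sum>m\<in>UNIV. kron (?M p m) (?M m q))" for p q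
  proof -
    \<comment> \<open>Both sides are matrices of partial maps: \<open>psi_psi\<close> matches the
      domains, \<open>psi_mul\<close> and \<open>assoc\<close> the two components.\<close>
    have "Rmat s ** kron (?M p q) (mat 1) = (\<Sum>m\<in>UNIV. kron (?M p m) (?M m q)) ** Rmat s"
      unfolding sum_kron_pcoeff unfolding Rmat_eq_pmat mat_1_eq_pmat pcoeff_def kron_pmat pmat_mult
      using psi_psi psi_mul assoc
      by (intro arg_cong[where f = pmat] ext) (auto simp: prod_eq_iff split: prod.splits)
    then show ?thesis
      by (simp add: matrix_mul_assoc[symmetric] Rmat_inverse(2))
  qed
  show ?thesis
    using positive_Phi_set_theoretic_basis[of "H_right s" \<iota>] assms
    by (auto simp: H_right_def Let_def slice slice_inv comult)
qed

lemma H_left_basis: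
  fixes \<iota> :: "'k::field \<Rightarrow> complex"
  assumes "field_embedding \<iota>"
  shows "\<exists>B :: ('k^'s^'s) set.
    positive_basis \<iota> (H_left s) B \<and> Phi_set_theoretic_basis (H_left s) B"
proof -
  let ?F = "\<lambda>j q. snd (s (j, q))" and ?G = "\<lambda>q j. fst (s (j, q))"
  let ?M = "\<lambda>p q. pcoeff ?F ?G p q :: 'k^'s^'s"
  interpret free_pair ?F ?G
    by (rule free_pair_swap[OF free_pair])
  have R: "Rmat s $ (i, p) $ (j, q) = ?M p q $ i $ j" for p i q j
    by (auto simp: Rmat_eq_pmat pcoeff_nth prod_eq_iff)
  have slice: "slice_right a (Rmat s) = pslice ?F ?G a" for a :: "'k^'s^'s \<Rightarrow> 'k"
    by (simp add: slice_right_def pslice_def R)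
  have slice_inv: "slice_right a (matrix_inv (Rmat s)) = pslice_antipode ?F ?G a"
    for a :: "'k^'s^'s \<Rightarrow> 'k"
    by (simp add: slice_right_def pslice_antipode_def R Rmat_inverse(1) transpose_nth)
  have comult: "matrix_inv (Rmat s) ** kron (mat 1) (?M p q) ** Rmat s =
      (\<Sum>m\<in>UNIV. kron (?M p m) (?M m q))" for p q
  proof -
    \<comment> \<open>Now \<open>assoc\<close> matches the domains, and \<open>psi_psi\<close> and
      \<open>psi_mul\<close> the components.\<close>
    have "kron (mat 1) (?M p q) ** Rmat s = Rmat s ** (\<Sum>m\<in>UNIV. kron (?M p m) (?M m q))"
      unfolding sum_kron_pcoeff unfolding Rmat_eq_pmat mat_1_eq_pmat pcoeff_def kron_pmat pmat_mult
      using psi_psi psi_mul assoc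
      by (intro arg_cong[where f = pmat] ext) (auto simp: prod_eq_iff split: prod.splits)
    then have "matrix_inv (Rmat s) ** (kron (mat 1) (?M p q) ** Rmat s) =
        (matrix_inv (Rmat s) ** Rmat s) ** (\<Sum>m\<in>UNIV. kron (?M p m) (?M m q))"
      by (simp only: matrix_mul_assoc)
    then show ?thesis
      by (simp add: matrix_mul_assoc Rmat_inverse(3))
  qed
  show ?thesis
    using positive_Phi_set_theoretic_basis[of "H_left s" \<iota>] assms
    by (auto simp: H_left_def Let_def slice slice_inv comult)
qed

end

theorem theorem1:
  fixes s :: "'s::finite \<times> 's \<Rightarrow> 's \<times> 's"
    and \<iota> :: "'k::field_char_0 \<Rightarrow> complex"
  assumes "field_embedding \<iota>"
    and "reversed_pentagon s"
    and "bij s"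
  shows "(\<exists>B :: ('k^'s^'s) set.
            positive_basis \<iota> (H_left s) B \<and> Phi_set_theoretic_basis (H_left s) B) \<and>
         (\<exists>B :: ('k^'s^'s) set.
            positive_basis \<iota> (H_right s) B \<and> Phi_set_theoretic_basis (H_right s) B)"
  using assms H_left_basis H_right_basis by blast

end
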